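(* Let $X^{\mathrm{in}}\subset\mathbb R^d$ be a nonempty polytope with $X^{\mathrm{in}}\neq\{0\}$, let $A$ be a real $d\times d$ matrix with spectral radius $\rho(A)<1$ admitting a decomposition $A=UDU^{-1}$ with $U$ a non-singular complex matrix and $D$ a complex diagonal matrix, let $Q$ be a real symmetric $d\times d$ matrix with $\lambda_{\max}(Q)\neq 0$, and let $q\in\mathbb R^d$. Let $\nu=(\nu_k)_{k\in\mathbb N}$, $\mathrm{Pos}^{>}_\nu$, $S_\nu^{n,m}$, $\mathbf K^{\geqslant}_\nu$ and $\mathbf K^{\rm diag}_\nu$ be as defined in the context, and assume $\mathrm{Pos}^{>}_\nu\neq\emptyset$. Let $$\mathbf K_\nu=\min_{k\in\mathrm{Pos}^{>}_\nu}\max\{k,\mathbf K^{\rm diag}_\nu(k)\}.$$ Then: 1. $\mathbf K_\nu=\max\{\mathbf K^{\geqslant}_\nu,\mathbf K^{\rm diag}_\nu(\mathbf K^{\geqslant}_\nu)\}$; 2. For all $k\in\mathrm{Pos}^{>}_\nu$, $S_\nu^{0,\infty}=S_\nu^{0,\mathbf K_\nu}=S_\nu^{0,\max\{k,\mathbf K^{\rm diag}_\nu(k)\}}$.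
   Context: $\mathbb N=\{0,1,2,\dots\}$. A polytope is the convex hull of finitely many points. $U^*$ is the conjugate transpose; $\lambda_{\max}(B)$ is the greatest eigenvalue of a Hermitian matrix $B$. For $k\in\mathbb N$, $\nu_k=\sup_{x\in X^{\mathrm{in}}}\left(x^\intercal (A^k)^\intercal QA^kx+q^\intercal A^kx\right)$; since $\rho(A)<1$, $\nu_k\to0$. $\mathrm{Pos}^{>}_\nu=\{k\in\mathbb N\mid\nu_k>0\}$. $S_\nu^{n,m}=\sup_{n\le k\le m}\nu_k$ and $S_\nu^{n,\infty}=\sup_{k\ge n}\nu_k$. $\mathbf K^{\geqslant}_\nu=\inf\{k\in\mathbb N\mid S_\nu^{0,k}\ge S_\nu^{k+1,\infty}\}$ (with $\inf\emptyset=+\infty$); when $\mathrm{Pos}^{>}_\nu\ne\emptyset$ it is finite and it is the smallest $k$ with $\nu_k=S_\nu^{0,\infty}$, so it belongs to $\mathrm{Pos}^{>}_\nu$. For a Hermitian matrix $B$, $\mu(B)=\sup_{x\in X^{\mathrm{in}}}x^\intercal Bx$. $V_{\rm diag}=\dfrac{\|U^*q\|_2}{2\sqrt{|\lambda_{\max}(U^*QU)|}}$ (here $\lambda_{\max}(U^*QU)\neq0$ because $\lambda_{\max}(Q)\neq0$). For $j\in\mathrm{Pos}^{>}_\nu$, $$\mathbf K^{\rm diag}_\nu(j)=\left\lfloor\frac{\ln\left(\left(\sqrt{\nu_j+V_{\rm diag}^2}-V_{\rm diag}\right)\left(\sqrt{|\lambda_{\max}(U^*QU)|\,\mu\left((UU^*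 )^{-1}\right)}\right)^{-1}\right)}{\ln(\rho(A))}\right\rfloor+1 .$$ In the degenerate case $\rho(A)=0$ the convention is $\ln 0=-\infty$ and $c/(-\infty)=0$ for real $c$, so that $\mathbf K^{\rm diag}_\nu(j)=1$. *)

theory Defs
  imports "HOL-Analysis.Analysis" "HOL-Library.Extended_Nat"
begin

(* The type class power on real^'d^'d is componentwise, hence a separate matrix power. *)
primrec matrix_power :: "'a::semiring_1^'d^'d \<Rightarrow> nat \<Rightarrow> 'a^'d^'d" where
  "matrix_power A 0 = mat 1"
| "matrix_power A (Suc k) = A ** matrix_power A k"

definition complex_vec :: "real^'d \<Rightarrow> complex^'d" where
  "complex_vec x = (\<chi> i. complex_of_real (x $ i))"

definition complex_matrix :: "real^'d^'d \<Rightarrow> complex^'d^'d" where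
  "complex_matrix A = map_matrix complex_of_real A"

definition conj_transpose :: "complex^'n^'m \<Rightarrow> complex^'m^'n" where
  "conj_transpose U = map_matrix cnj (transpose U)"

definition diagonal_matrix :: "'a::zero^'d^'d \<Rightarrow> bool" where
  "diagonal_matrix D \<longleftrightarrow> (\<forall>i j. i \<noteq> j \<longrightarrow> D $ i $ j = 0)"

definition eigenvalue :: "complex^'d^'d \<Rightarrow> complex \<Rightarrow> bool" where
  "eigenvalue B c \<longleftrightarrow> (\<exists>v. v \<noteq> 0 \<and> B *v v = c *s v)"

definition spectral_radius :: "complex^'d^'d \<Rightarrow> real" where
  "spectral_radius B = Max (norm ` {c. eigenvalue B c})"

(* Meant for Hermitian B, all of whose eigenvalues are real. *)
definition lambda_max :: "complex^'d^'d \<Rightarrow> real" where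
  "lambda_max B = Max {t. eigenvalue B (complex_of_real t)}"

(* For Hermitian B and real x the number x^T B x is real, so Re loses nothing. *)
definition mu :: "(real^'d) set \<Rightarrow> complex^'d^'d \<Rightarrow> real" where
  "mu X B = (SUP x\<in>X. Re (scalar_product (complex_vec x) (B *v complex_vec x)))"

definition nu :: "(real^'d) set \<Rightarrow> real^'d^'d \<Rightarrow> real^'d^'d \<Rightarrow> real^'d \<Rightarrow> nat \<Rightarrow> real" where
  "nu X A Q q k =
    (SUP x\<in>X. x \<bullet> ((transpose (matrix_power A k) ** Q ** matrix_power A k) *v x)
             + q \<bullet> (matrix_power A k *v x))"

definition Pos :: "(nat \<Rightarrow> real) \<Rightarrow> nat set" where
  "Pos \<nu> = {k. \<nu> k > 0}"

definition S :: "(nat \<Rightarrow> real) \<Rightarrow> nat \<Rightarrow> enat \<Rightarrow> real" where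
  "S \<nu> n m = (SUP k\<in>{k. n \<le> k \<and> enat k \<le> m}. \<nu> k)"

(* In enat, Inf {} = \<infinity>. *)
definition K_geq :: "(nat \<Rightarrow> real) \<Rightarrow> enat" where
  "K_geq \<nu> = Inf {enat k | k. S \<nu> 0 (enat k) \<ge> S \<nu> (k + 1) \<infinity>}"

definition V_diag :: "complex^'d^'d \<Rightarrow> real^'d^'d \<Rightarrow> real^'d \<Rightarrow> real" where
  "V_diag U Q q =
    norm (conj_transpose U *v complex_vec q)
    / (2 * sqrt \<bar>lambda_max (conj_transpose U ** complex_matrix Q ** U)\<bar>)"

(* The first branch is the convention ln 0 = -\<infinity>, c / (-\<infinity>) = 0. *)
definition K_diag ::
  "(real^'d) set \<Rightarrow> real^'d^'d \<Rightarrow> complex^'d^'d \<Rightarrow> real^'d^'d \<Rightarrow> real^'d \<Rightarrow> nat \<Rightarrow> int" where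
  "K_diag X A U Q q j =
    (let \<rho> = spectral_radius (complex_matrix A);
         V = V_diag U Q q;
         l = \<bar>lambda_max (conj_transpose U ** complex_matrix Q ** U)\<bar>;
         c = (sqrt (nu X A Q q j + V\<^sup>2) - V)
             * inverse (sqrt (l * mu X (matrix_inv (U ** conj_transpose U))))
     in \<lfloor>if \<rho> = 0 then 0 else ln c / ln \<rho>\<rfloor> + 1)"

(* max {k, K_diag k}; it is at least k, so nat does not truncate. *)
definition K_bound ::
  "(real^'d) set \<Rightarrow> real^'d^'d \<Rightarrow> complex^'d^'d \<Rightarrow> real^'d^'d \<Rightarrow> real^'d \<Rightarrow> nat \<Rightarrow> nat" where
  "K_bound X A U Q q k = nat (max (int k) (K_diag X A U Q q k))"

definition K_min ::
  "(real^'d) set \<Rightarrow> real^'d^'d \<Rightarrow> complex^'d^'d \<Rightarrow> real^'d^'d \<Rightarrow> real^'d \<Rightarrow> nat" where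
  "K_min X A U Q q = (LEAST n. n \<in> K_bound X A U Q q ` Pos (nu X A Q q))"

end

theory Submission
  imports Defs
begin

text \<open>
  Two properties of the rank bound \<open>\<kappa> = K_diag\<close> on the positive terms of \<open>\<nu>\<close> carry everything.
  Past rank \<open>\<kappa> j\<close> the sequence stays strictly below \<open>\<nu> j\<close>, and \<open>\<kappa> j\<close> does not grow when
  \<open>\<nu> j\<close> grows. By the first property the supremum of \<open>\<nu>\<close> is attained; let \<open>K\<close> be its first maximiser,
  which is also the value of \<open>K_geq\<close>. For a positive term \<open>k\<close> the first property gives \<open>K < \<kappa> k\<close>,
  since \<open>\<nu> K\<close> is not below \<open>\<nu> k\<close>, and the second gives \<open>\<kappa> K \<le> \<kappa> k\<close>. So
  \<open>max K (\<kappa> K) \<le> max k (\<kappa> k)\<close>: the minimum over \<open>k\<close> is attained at \<open>K\<close>, and every window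
  \<open>{0..max k (\<kappa> k)}\<close> contains the maximiser \<open>K\<close>, so its supremum is that of the whole sequence
  (\<open>rank_bound_minimal_at_maximiser\<close>, \<open>K_geq_eq_least_maximiser\<close>, \<open>S_eq_maximum\<close>).

  The two properties (\<open>K_diag_correct\<close>) come from a geometric majorant of \<open>\<nu>\<close>. In the coordinates
  \<open>z = U\<^sup>-\<^sup>1 y\<close> the quadratic part of the objective is \<open>z\<^sup>* (U\<^sup>*QU) z\<close>, which the Rayleigh bound
  controls by \<open>l \<parallel>z\<parallel>\<^sup>2\<close> with \<open>l = \<bar>\<lambda>\<^sub>m\<^sub>a\<^sub>x(U\<^sup>*QU)\<bar>\<close>, and the linear part is at most
  \<open>\<parallel>U\<^sup>*q\<parallel> \<parallel>z\<parallel> = 2 \<surd>l V \<parallel>z\<parallel>\<close> by Cauchy-Schwarz. Along an orbit, \<open>z\<close> is multiplied by \<open>D\<close> at each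
  step, so \<open>\<parallel>z\<parallel> \<le> \<rho>\<^sup>k \<surd>\<mu>\<close>, where \<open>\<mu>\<close> bounds the squared initial norms. Completing the square,
  \<open>\<nu> k \<le> (\<surd>(l\<mu>) \<rho>\<^sup>k + V)\<^sup>2 - V\<^sup>2\<close> (\<open>nu_le\<close>), and for \<open>\<rho> > 0\<close>
  the bound \<open>\<kappa> j\<close> is the first integer strictly above the real
  \<open>k\<close> at which this majorant equals \<open>\<nu> j\<close>. Dividing by \<open>l\<close> requires \<open>l \<noteq> 0\<close>; the hypothesis
  \<open>\<lambda>\<^sub>m\<^sub>a\<^sub>x(Q) \<noteq> 0\<close> gives it because a vanishing greatest eigenvalue is preserved by the congruence
  with \<open>U\<close> (\<open>lambda_max_congruence_nonzero\<close>).
\<close>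

section \<open>Sequences whose tails are dominated by their positive terms\<close>

text \<open>A single positive term \<open>j\<close> dominates the tail past \<open>\<kappa> j\<close>, so a maximum over a finite initial
  segment containing \<open>j\<close> is a global maximum.\<close>

lemma least_maximiser_exists:
  fixes \<nu> :: "nat \<Rightarrow> real" and \<kappa> :: "nat \<Rightarrow> int"
  assumes tail: "\<And>j k. j \<in> Pos \<nu> \<Longrightarrow> \<kappa> j \<le> int k \<Longrightarrow> \<nu> k < \<nu> j"
    and "Pos \<nu> \<noteq> {}"
  obtains K where "K \<in> Pos \<nu>" "\<And>k. \<nu> k \<le> \<nu> K" "\<And>k. k < K \<Longrightarrow> \<nu> k < \<nu> K"
proof -
  obtain j where j: "j \<in> Pos \<nu>" using assms(2) by auto
  define N where "N = max j (nat (\<kappa> j))"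
  obtain m where m: "m \<le> N" "\<And>k. k \<le> N \<Longrightarrow> \<nu> k \<le> \<nu> m"
  proof -
    have "Max (\<nu> ` {..N}) \<in> \<nu> ` {..N}" by (rule Max_in) auto
    then obtain m where "m \<le> N" "\<nu> m = Max (\<nu> ` {..N})" by (metis atMost_iff imageE)
    then show ?thesis by (intro that[of m]) auto
  qed
  have "\<nu> j \<le> \<nu> m" by (rule m(2)) (simp add: N_def)
  have "\<nu> k \<le> \<nu> m" for k
  proof (cases "k \<le> N")
    case False
    then have "\<nu> k < \<nu> j" by (intro tail[OF j]) (simp add: N_def)
    then show ?thesis using \<open>\<nu> j \<le> \<nu> m\<close> by simp
  qed (rule m(2))
  then have ex: "\<exists>m. \<forall>k. \<nu> k \<le> \<nu> m" by blast
  define K where "K = (LEAST m. \<forall>k. \<nu> k \<le> \<nu> m)"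
  have max: "\<nu> k \<le> \<nu> K" for k using LeastI_ex[OF ex] unfolding K_def by blast
  have less: "\<nu> k < \<nu> K" if "k < K" for k
  proof -
    have "\<not> (\<forall>i. \<nu> i \<le> \<nu> k)" using that not_less_Least unfolding K_def by blast
    then obtain i where "\<nu> k < \<nu> i" by (auto simp: not_le)
    also have "\<nu> i \<le> \<nu> K" by (rule max)
    finally show ?thesis .
  qed
  have "K \<in> Pos \<nu>" using j max[of j] by (simp add: Pos_def)
  then show ?thesis using max less by (rule that)
qed

lemma S_eq_maximum:
  assumes "\<And>k. \<nu> k \<le> \<nu> K" "n \<le> K" "enat K \<le> m"
  shows "S \<nu> n m = \<nu> K"
  unfolding S_def using assms by (intro cSup_eq_maximum) auto

text \<open>For \<open>k < K\<close> the initial supremum is a maximum of finitely many terms, all below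
  \<open>\<nu> K\<close>, while \<open>K\<close> still lies in the tail; at \<open>k = K\<close> the comparison reverses.\<close>

lemma K_geq_eq_least_maximiser:
  assumes max: "\<And>k. \<nu> k \<le> \<nu> K" and less: "\<And>k. k < K \<Longrightarrow> \<nu> k < \<nu> K"
  shows "K_geq \<nu> = enat K"
  unfolding K_geq_def
proof (intro antisym Inf_lower Inf_greatest)
  have "S \<nu> (K + 1) \<infinity> \<le> \<nu> K"
    unfolding S_def using max by (intro cSUP_least) auto
  then show "enat K \<in> {enat k |k. S \<nu> (k + 1) \<infinity> \<le> S \<nu> 0 (enat k)}"
    using S_eq_maximum[of \<nu> K 0 "enat K"] max by auto
next
  fix e assume "e \<in> {enat k |k. S \<nu> (k + 1) \<infinity> \<le> S \<nu> 0 (enat k)}"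
  then obtain k where e: "e = enat k" and le: "S \<nu> (k + 1) \<infinity> \<le> S \<nu> 0 (enat k)" by auto
  show "enat K \<le> e"
  proof (rule ccontr)
    assume "\<not> enat K \<le> e"
    then have "k < K" using e by simp
    then have "S \<nu> (k + 1) \<infinity> = \<nu> K" by (intro S_eq_maximum max) auto
    moreover have "S \<nu> 0 (enat k) < \<nu> K"
    proof -
      have eq: "{i. 0 \<le> i \<and> enat i \<le> enat k} = {..k}" by auto
      have "S \<nu> 0 (enat k) = Max (\<nu> ` {..k})"
        unfolding S_def eq by (intro cSup_eq_Max) auto
      also have "\<dots> \<in> \<nu> ` {..k}" by (rule Max_in) auto
      finally show ?thesis using less \<open>k < K\<close> by auto
    qed
    ultimately show False using le by simp
  qed
qed

text \<open>The maximiser \<open>K\<close> cannot lie in the tail that \<open>\<nu> k\<close> strictly dominates, hence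
  \<open>K < \<kappa> k\<close>; antitonicity of \<open>\<kappa>\<close> handles the other argument of the maximum.\<close>

lemma rank_bound_minimal_at_maximiser:
  fixes \<nu> :: "nat \<Rightarrow> real" and \<kappa> :: "nat \<Rightarrow> int"
  assumes tail: "\<And>j k. j \<in> Pos \<nu> \<Longrightarrow> \<kappa> j \<le> int k \<Longrightarrow> \<nu> k < \<nu> j"
    and anti: "\<And>i j. i \<in> Pos \<nu> \<Longrightarrow> \<nu> i \<le> \<nu> j \<Longrightarrow> \<kappa> j \<le> \<kappa> i"
    and max: "\<And>k. \<nu> k \<le> \<nu> K" and k: "k \<in> Pos \<nu>"
  shows "max (int K) (\<kappa> K) \<le> max (int k) (\<kappa> k)"
proof -
  have "\<kappa> K \<le> \<kappa> k" using k max by (rule anti)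
  moreover have "int K < \<kappa> k"
    using tail[OF k, of K] max[of k] by force
  ultimately show ?thesis by linarith
qed

section \<open>Complex matrices on a real Euclidean space\<close>

text \<open>The inner product \<open>\<bullet>\<close> on complex vectors is the real part of the Hermitian one, and the
  conjugate transpose is the adjoint for it as well. Hermitian matrices thus become self-adjoint
  operators on a real Euclidean space, where compactness and orthogonality arguments apply
  directly.\<close>

lemma inner_conj_transpose:
  "x \<bullet> (M *v y) = (conj_transpose M *v x) \<bullet> (y :: complex^'n)" for x :: "complex^'m"
proof -
  have "x \<bullet> (M *v y) = (\<Sum>i\<in>UNIV. \<Sum>j\<in>UNIV. x $ i \<bullet> (M $ i $ j * y $ j))"
    by (simp add: inner_vec_def matrix_vector_mult_def inner_sum_right)
  also have "\<dots> = (\<Sum>j\<in>UNIV. \<Sum>i\<in>UNIV. x $ i \<bullet> (M $ i $ j * y $ j))"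
    by (rule sum.swap)
  also have "\<dots> = (\<Sum>j\<in>UNIV. \<Sum>i\<in>UNIV. (cnj (M $ i $ j) * x $ i) \<bullet> y $ j)"
    by (intro sum.cong refl) (simp add: inner_complex_def algebra_simps)
  also have "\<dots> = (conj_transpose M *v x) \<bullet> y"
    by (simp add: inner_vec_def matrix_vector_mult_def inner_sum_left conj_transpose_def
        map_matrix_def transpose_def)
  finally show ?thesis .
qed

lemma conj_transpose_mult:
  "conj_transpose (M ** N) = conj_transpose N ** conj_transpose M"
  by (simp add: vec_eq_iff conj_transpose_def map_matrix_def transpose_def
      matrix_matrix_mult_def mult.commute)

lemma conj_transpose_conj_transpose [simp]: "conj_transpose (conj_transpose M) = M"
  by (simp add: vec_eq_iff conj_transpose_def map_matrix_def transpose_def)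

lemma conj_transpose_mat_1 [simp]: "conj_transpose (mat 1) = mat 1"
  by (auto simp: vec_eq_iff conj_transpose_def map_matrix_def transpose_def mat_def)

lemma conj_transpose_complex_matrix:
  "conj_transpose (complex_matrix M) = complex_matrix (transpose M)"
  by (simp add: vec_eq_iff conj_transpose_def complex_matrix_def map_matrix_def transpose_def)

lemma complex_matrix_vector_mult: "complex_vec (M *v x) = complex_matrix M *v complex_vec x"
  by (simp add: vec_eq_iff complex_matrix_def complex_vec_def map_matrix_def
      matrix_vector_mult_def)

lemma inner_complex_vec: "complex_vec x \<bullet> complex_vec y = x \<bullet> y"
  by (simp add: inner_vec_def complex_vec_def inner_complex_def)

lemma norm_complex_vec: "norm (complex_vec x) = norm x"
  by (simp add: norm_eq_sqrt_inner inner_complex_vec)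

lemma Re_scalar_product_complex_vec:
  "Re (scalar_product (complex_vec x) z) = complex_vec x \<bullet> z"
  by (simp add: scalar_product_def inner_vec_def complex_vec_def inner_complex_def)

lemma complex_of_real_smult: "complex_of_real t *s v = t *\<^sub>R v"
  by (simp add: vec_eq_iff scaleR_conv_of_real[where 'a=complex])

lemma linear_matrix_vector_mult_complex: "linear ((*v) (M :: complex^'n^'m))"
proof (rule linearI)
  show "M *v (c *\<^sub>R x) = c *\<^sub>R (M *v x)" for c x
    by (simp add: vector_scalar_commute flip: complex_of_real_smult)
qed (rule matrix_vector_right_distrib)

section \<open>The Rayleigh bound and the greatest eigenvalue\<close>

text \<open>A maximiser \<open>v\<close> of the quadratic form on the unit sphere is an eigenvector: the form
  \<open>t * (x \<bullet> x) - x \<bullet> f x\<close> is nonnegative and vanishes at \<open>v\<close>, so its first variation at \<open>v\<close>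
  is zero.\<close>

lemma self_adjoint_greatest_eigenvalue:
  fixes f :: "'a::euclidean_space \<Rightarrow> 'a"
  assumes "linear f" and adj: "\<And>x y. x \<bullet> f y = f x \<bullet> y"
  obtains v t where "v \<noteq> 0" "f v = t *\<^sub>R v" "\<And>x. x \<bullet> f x \<le> t * (x \<bullet> x)"
proof -
  interpret linear f by fact
  have cont: "continuous_on (sphere 0 1) (\<lambda>x. x \<bullet> f x)"
    by (intro continuous_intros linear_continuous_on linear_linear[THEN iffD2] \<open>linear f\<close>)
  obtain v where v: "norm v = 1" and max: "\<And>x. norm x = 1 \<Longrightarrow> x \<bullet> f x \<le> v \<bullet> f v"
    using continuous_attains_sup[OF compact_sphere _ cont] by auto
  define t where "t = v \<bullet> f v"
  have le: "x \<bullet> f x \<le> t * (x \<bullet> x)" for x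
  proof (cases "x = 0")
    case False
    have "norm x *\<^sub>R sgn x = x" using False by (simp add: sgn_div_norm)
    moreover have "(norm x *\<^sub>R sgn x) \<bullet> f (norm x *\<^sub>R sgn x)
        = (norm x)\<^sup>2 * (sgn x \<bullet> f (sgn x))"
      by (simp only: scaleR inner_scaleR_left inner_scaleR_right power2_eq_square mult.assoc)
    ultimately have "x \<bullet> f x = (norm x)\<^sup>2 * (sgn x \<bullet> f (sgn x))" by (simp only:)
    also have "\<dots> \<le> (norm x)\<^sup>2 * t"
      unfolding t_def using False by (intro mult_left_mono max) (auto simp: norm_sgn)
    finally show ?thesis by (simp add: power2_norm_eq_inner mult.commute)
  qed (simp add: zero)
  \<comment> \<open>Moving from \<open>v\<close> along the residual \<open>w\<close> changes the nonnegative form by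
      \<open>s\<^sup>2 g - 2 s (w \<bullet> w)\<close>, which is negative for small positive \<open>s\<close> unless \<open>w = 0\<close>.\<close>
  define w where "w = f v - t *\<^sub>R v"
  have "w = 0"
  proof (rule ccontr)
    assume "w \<noteq> 0"
    define g where "g = t * (w \<bullet> w) - w \<bullet> f w"
    have quad: "2 * s * (w \<bullet> w) \<le> s\<^sup>2 * g" for s
    proof -
      have "t * ((v + s *\<^sub>R w) \<bullet> (v + s *\<^sub>R w)) - (v + s *\<^sub>R w) \<bullet> f (v + s *\<^sub>R w)
          = t * (v \<bullet> v) - v \<bullet> f v + 2 * s * (t * (v \<bullet> w) - f v \<bullet> w) + s\<^sup>2 * g"
        by (simp add: add scaleR inner_add_left inner_add_right g_def adj[of v w]
            inner_commute[of w v] inner_commute[of w "f v"] power2_eq_square algebra_simps)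
      moreover have "v \<bullet> v = 1" using v by (simp add: norm_eq_1)
      moreover have "t * (v \<bullet> w) - f v \<bullet> w = - (w \<bullet> w)"
        by (simp add: w_def inner_diff_left)
      ultimately show ?thesis using le[of "v + s *\<^sub>R w"] by (simp add: t_def)
    qed
    have ww: "w \<bullet> w > 0" using \<open>w \<noteq> 0\<close> by simp
    have "g > 0" using quad[of 1] ww by (simp del: inner_gt_zero_iff)
    then have "((w \<bullet> w) / g)\<^sup>2 * g = (w \<bullet> w) / g * (w \<bullet> w)"
      by (simp add: power2_eq_square)
    then have "(w \<bullet> w) / g * (w \<bullet> w) \<le> 0" using quad[of "(w \<bullet> w) / g"] by simp
    moreover have "(w \<bullet> w) / g * (w \<bullet> w) > 0"
      using ww \<open>g > 0\<close> by (intro mult_pos_pos divide_pos_pos)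
    ultimately show False by simp
  qed
  then show ?thesis using v le by (intro that[of v t]) (auto simp: w_def)
qed

lemma hermitian_inner:
  "conj_transpose B = B \<Longrightarrow> x \<bullet> (B *v y) = (B *v x) \<bullet> y"
  by (metis inner_conj_transpose)

text \<open>Eigenvectors of distinct real eigenvalues are orthogonal, hence linearly independent over
  the reals. Finiteness makes the \<open>Max\<close> in \<open>lambda_max\<close> meaningful.\<close>

lemma finite_real_eigenvalues_hermitian:
  fixes B :: "complex^'d^'d"
  assumes "conj_transpose B = B"
  shows "finite {t. eigenvalue B (complex_of_real t)}"
proof -
  let ?E = "{t. eigenvalue B (complex_of_real t)}"
  have "\<forall>t. \<exists>v. t \<in> ?E \<longrightarrow> v \<noteq> 0 \<and> B *v v = t *\<^sub>R v"
    by (auto simp: eigenvalue_def complex_of_real_smult)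
  then obtain e where e: "\<And>t. t \<in> ?E \<Longrightarrow> e t \<noteq> 0 \<and> B *v e t = t *\<^sub>R e t"
    by metis
  have orth: "e s \<bullet> e t = 0" if "s \<in> ?E" "t \<in> ?E" "s \<noteq> t" for s t
  proof -
    have "t * (e s \<bullet> e t) = s * (e s \<bullet> e t)"
      using hermitian_inner[OF assms, of "e s" "e t"] e that by simp
    then show ?thesis using that by simp
  qed
  have "inj_on e ?E"
    using orth e by (intro inj_onI) (metis inner_eq_zero_iff)
  moreover have "finite (e ` ?E)"
  proof -
    have "pairwise orthogonal (e ` ?E)"
      unfolding pairwise_def orthogonal_def using orth by (auto; metis)
    moreover have "0 \<notin> e ` ?E" using e by force
    ultimately show ?thesis
      using pairwise_orthogonal_independent independent_imp_finite by blast
  qed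
  ultimately show ?thesis by (rule finite_imageD[rotated])
qed

lemma lambda_max_hermitian:
  fixes B :: "complex^'d^'d"
  assumes "conj_transpose B = B"
  shows eigenvalue_lambda_max: "eigenvalue B (complex_of_real (lambda_max B))"
    and rayleigh_bound: "x \<bullet> (B *v x) \<le> lambda_max B * (norm x)\<^sup>2"
proof -
  obtain v t where vt: "v \<noteq> 0" "B *v v = t *\<^sub>R v" "\<And>x. x \<bullet> (B *v x) \<le> t * (x \<bullet> x)"
    using self_adjoint_greatest_eigenvalue[of "(*v) B"]
      linear_matrix_vector_mult_complex hermitian_inner[OF assms] by metis
  note fin = finite_real_eigenvalues_hermitian[OF assms]
  have t: "t \<in> {t. eigenvalue B (complex_of_real t)}"
    using vt by (auto simp: eigenvalue_def complex_of_real_smult)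
  then show "eigenvalue B (complex_of_real (lambda_max B))"
    using Max_in[OF fin] unfolding lambda_max_def by blast
  have "t \<le> lambda_max B" unfolding lambda_max_def using fin t by (rule Max_ge)
  then have "t * (x \<bullet> x) \<le> lambda_max B * (x \<bullet> x)"
    by (intro mult_right_mono) auto
  with vt(3)[of x] show "x \<bullet> (B *v x) \<le> lambda_max B * (norm x)\<^sup>2"
    by (simp add: power2_norm_eq_inner)
qed

lemma matrix_inv_mult:
  assumes "invertible M"
  shows "M ** matrix_inv M = mat 1" "matrix_inv M ** M = mat 1"
  using someI_ex[OF assms[unfolded invertible_def]] unfolding matrix_inv_def by auto

lemma matrix_inv_unique:
  assumes "M ** N = mat 1" "N ** M = mat 1"
  shows "matrix_inv M = N"
proof -
  have "invertible M" using assms by (auto simp: invertible_def)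
  then have "N ** (M ** matrix_inv M) = N" by (simp add: matrix_inv_mult)
  then show ?thesis by (simp add: matrix_mul_assoc assms)
qed

lemma hermitian_congruence:
  "conj_transpose H = H \<Longrightarrow> conj_transpose (conj_transpose U ** H ** U) = conj_transpose U ** H ** U"
  by (simp add: conj_transpose_mult matrix_mul_assoc)

lemma inner_congruence:
  "z \<bullet> ((conj_transpose U ** H ** U) *v z) = (U *v z) \<bullet> (H *v (U *v z))"
proof -
  have "z \<bullet> ((conj_transpose U ** H ** U) *v z) = z \<bullet> (conj_transpose U *v (H *v (U *v z)))"
    by (simp only: matrix_vector_mul_assoc matrix_mul_assoc)
  also have "\<dots> = (conj_transpose (conj_transpose U) *v z) \<bullet> (H *v (U *v z))"
    by (rule inner_conj_transpose)
  finally show ?thesis by simp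
qed

text \<open>If \<open>\<lambda>\<^sub>m\<^sub>a\<^sub>x(U\<^sup>*HU) = 0\<close>, then \<open>U\<^sup>*HU\<close> is negative semidefinite and singular. Both
  properties transfer to \<open>H\<close> through the bijection \<open>z \<mapsto> U z\<close>, and together they say
  \<open>\<lambda>\<^sub>m\<^sub>a\<^sub>x(H) = 0\<close>. This is the fragment of Sylvester's law of inertia that the argument needs.\<close>

lemma lambda_max_congruence_nonzero:
  fixes H U :: "complex^'d^'d"
  assumes herm: "conj_transpose H = H" and "invertible U" and "lambda_max H \<noteq> 0"
  shows "lambda_max (conj_transpose U ** H ** U) \<noteq> 0"
proof
  let ?B = "conj_transpose U ** H ** U"
  assume zero: "lambda_max ?B = 0"
  note hermB = hermitian_congruence[OF herm, of U]
  note inv = matrix_inv_mult[OF \<open>invertible U\<close>]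
  obtain v where v: "v \<noteq> 0" "?B *v v = 0"
    using eigenvalue_lambda_max[OF hermB] zero by (auto simp: eigenvalue_def)
  have "conj_transpose (matrix_inv U) ** conj_transpose U = mat 1"
    using inv by (simp flip: conj_transpose_mult)
  then have "conj_transpose (matrix_inv U) ** ?B = H ** U"
    by (simp add: matrix_mul_assoc)
  then have "H *v (U *v v) = conj_transpose (matrix_inv U) *v (?B *v v)"
    by (simp only: matrix_vector_mul_assoc)
  also have "\<dots> = 0" using v by simp
  finally have "H *v (U *v v) = 0" .
  moreover have "U *v v \<noteq> 0"
  proof
    assume "U *v v = 0"
    then have "matrix_inv U *v (U *v v) = 0" by simp
    then show False using v(1) by (simp add: matrix_vector_mul_assoc inv)
  qed
  ultimately have "eigenvalue H (complex_of_real 0)"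
    unfolding eigenvalue_def by (intro exI[of _ "U *v v"]) simp
  moreover have "t \<le> 0" if ev: "eigenvalue H (complex_of_real t)" for t
  proof -
    obtain w where w: "w \<noteq> 0" "H *v w = t *\<^sub>R w"
      using ev by (auto simp: eigenvalue_def complex_of_real_smult)
    have "U *v (matrix_inv U *v w) = w"
      using inv by (simp add: matrix_vector_mul_assoc)
    then have "w \<bullet> (H *v w) \<le> 0"
      using rayleigh_bound[OF hermB, of "matrix_inv U *v w"] zero
      by (simp add: inner_congruence)
    then have "t * (w \<bullet> w) \<le> 0" using w(2) by simp
    moreover have "w \<bullet> w > 0" using w(1) by simp
    ultimately show ?thesis by (meson mult_pos_pos not_le)
  qed
  ultimately have "lambda_max H = 0"
    unfolding lambda_max_def
    by (intro Max_eqI finite_real_eigenvalues_hermitian[OF herm]) auto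
  then show False using assms(3) by simp
qed

section \<open>Powers of a diagonalisable matrix\<close>

lemma diagonal_matrix_vector_mult:
  assumes "diagonal_matrix D"
  shows "(D *v w) $ i = D $ i $ i * w $ i"
proof -
  have "(D *v w) $ i = (\<Sum>j\<in>UNIV. if j = i then D $ i $ i * w $ i else 0)"
    unfolding matrix_vector_mult_def vec_lambda_beta using assms
    by (intro sum.cong refl) (auto simp: diagonal_matrix_def)
  then show ?thesis by simp
qed

lemma eigenvalue_similar_diagonal_iff:
  fixes U D :: "complex^'d^'d"
  assumes "invertible U" "diagonal_matrix D" "M = U ** D ** matrix_inv U"
  shows "eigenvalue M c \<longleftrightarrow> (\<exists>i. c = D $ i $ i)"
proof -
  note inv = matrix_inv_mult[OF \<open>invertible U\<close>]
  note D = diagonal_matrix_vector_mult[OF assms(2)]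
  show ?thesis
  proof
    assume "eigenvalue M c"
    then obtain v where v: "v \<noteq> 0" "M *v v = c *s v" by (auto simp: eigenvalue_def)
    define w where "w = matrix_inv U *v v"
    have "U *v w = v" using inv by (simp add: w_def matrix_vector_mul_assoc)
    then have "w \<noteq> 0" using v by auto
    then obtain i where i: "w $ i \<noteq> 0" by (auto simp: vec_eq_iff)
    have "D *v w = matrix_inv U *v (M *v v)"
      using inv by (simp add: w_def assms(3) matrix_vector_mul_assoc matrix_mul_assoc)
    also have "\<dots> = c *s w"
      by (simp add: v w_def vector_scalar_commute)
    finally have "D $ i $ i * w $ i = c * w $ i" by (metis D vector_smult_component)
    then show "\<exists>i. c = D $ i $ i" using i by auto
  next
    assume "\<exists>i. c = D $ i $ i"
    then obtain i where c: "c = D $ i $ i" by auto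
    let ?a = "axis i 1 :: complex^'d"
    have Da: "D *v ?a = c *s ?a" by (auto simp: vec_eq_iff D c axis_def)
    have "matrix_inv U *v (U *v ?a) = ?a" using inv by (simp add: matrix_vector_mul_assoc)
    then have "U *v ?a \<noteq> 0" by (metis axis_eq_0_iff matrix_vector_mult_0_right zero_neq_one)
    moreover have "M *v (U *v ?a) = U *v (D *v ?a)"
      using inv by (simp add: assms(3) matrix_vector_mul_assoc flip: matrix_mul_assoc)
    then have "M *v (U *v ?a) = c *s (U *v ?a)"
      by (simp add: Da vector_scalar_commute)
    ultimately show "eigenvalue M c" by (auto simp: eigenvalue_def)
  qed
qed

lemma norm_diagonal_mult_le:
  fixes D :: "complex^'d^'d"
  assumes "diagonal_matrix D" "\<And>i. norm (D $ i $ i) \<le> r" "0 \<le> r"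
  shows "norm (D *v z) \<le> r * norm z"
proof -
  have "norm (D *v z) \<le> norm (r *\<^sub>R z)"
    using assms(2,3)
    by (intro norm_le_componentwise_cart) (auto simp: diagonal_matrix_vector_mult[OF assms(1)] norm_mult intro!: mult_right_mono)
  then show ?thesis using assms(3) by simp
qed

lemma spectral_radius_similar_diagonal:
  fixes U D :: "complex^'d^'d"
  assumes "invertible U" "diagonal_matrix D" "M = U ** D ** matrix_inv U"
  shows norm_diagonal_le_spectral_radius: "norm (D $ i $ i) \<le> spectral_radius M"
    and spectral_radius_nonneg: "0 \<le> spectral_radius M"
proof -
  have "{c. eigenvalue M c} = range (\<lambda>i. D $ i $ i)"
    by (auto simp: eigenvalue_similar_diagonal_iff[OF assms])
  then show le: "norm (D $ i $ i) \<le> spectral_radius M" for i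
    unfolding spectral_radius_def by (intro Max_ge) auto
  show "0 \<le> spectral_radius M" using norm_ge_zero le by (rule order_trans)
qed

text \<open>Passing to the coordinates \<open>U\<^sup>-\<^sup>1\<close> turns each multiplication by \<open>A\<close> into one by \<open>D\<close>,
  which multiplies the Euclidean norm by at most \<open>\<rho>(A)\<close>; in the original coordinates the condition number of
  \<open>U\<close> would enter.\<close>

lemma norm_diagonal_coordinates_power_le:
  fixes U D :: "complex^'d^'d" and A :: "real^'d^'d"
  assumes "invertible U" "diagonal_matrix D" "complex_matrix A = U ** D ** matrix_inv U"
  shows "norm (matrix_inv U *v complex_vec (matrix_power A k *v x))
    \<le> spectral_radius (complex_matrix A) ^ k * norm (matrix_inv U *v complex_vec x)"
proof (induction k)
  case (Suc k)
  let ?r = "spectral_radius (complex_matrix A)"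
  let ?z = "matrix_inv U *v complex_vec (matrix_power A k *v x)"
  have "complex_vec (matrix_power A (Suc k) *v x)
      = complex_matrix A *v complex_vec (matrix_power A k *v x)"
    by (simp flip: complex_matrix_vector_mult matrix_vector_mul_assoc)
  then have "matrix_inv U *v complex_vec (matrix_power A (Suc k) *v x) = D *v ?z"
    by (simp add: assms(3) matrix_vector_mul_assoc matrix_mul_assoc matrix_inv_mult[OF assms(1)])
  also have "norm \<dots> \<le> ?r * norm ?z"
    using assms by (intro norm_diagonal_mult_le norm_diagonal_le_spectral_radius
        spectral_radius_nonneg)
  also have "\<dots> \<le> ?r * (?r ^ k * norm (matrix_inv U *v complex_vec x))"
    using assms by (intro mult_left_mono Suc spectral_radius_nonneg)
  finally show ?case by (simp add: mult.assoc)
qed simp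

section \<open>Geometric majorant of the optimal values\<close>

text \<open>The matrix \<open>(UU\<^sup>*)\<^sup>-\<^sup>1\<close> in the argument of \<open>mu\<close> represents the squared norm in the
  diagonalising coordinates, so \<open>mu\<close> is the largest such squared norm over the initial set.\<close>

lemma inner_inverse_gram:
  fixes U :: "complex^'d^'d"
  assumes "invertible U"
  shows "z \<bullet> (matrix_inv (U ** conj_transpose U) *v z) = (norm (matrix_inv U *v z))\<^sup>2"
proof -
  let ?W = "matrix_inv U"
  note inv = matrix_inv_mult[OF assms]
  have cinv: "conj_transpose U ** conj_transpose ?W = mat 1"
      "conj_transpose ?W ** conj_transpose U = mat 1"
    using inv by (simp_all flip: conj_transpose_mult)
  have "U ** conj_transpose U ** (conj_transpose ?W ** ?W)
      = U ** (conj_transpose U ** conj_transpose ?W) ** ?W"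
    by (simp add: matrix_mul_assoc)
  moreover have "conj_transpose ?W ** ?W ** (U ** conj_transpose U)
      = conj_transpose ?W ** (?W ** U) ** conj_transpose U"
    by (simp add: matrix_mul_assoc)
  ultimately have "matrix_inv (U ** conj_transpose U) = conj_transpose ?W ** ?W"
    using inv cinv by (intro matrix_inv_unique) simp_all
  then show ?thesis
    using inner_congruence[of z ?W "mat 1"] by (simp add: power2_norm_eq_inner)
qed

lemma mu_inverse_gram:
  fixes U :: "complex^'d^'d" and X :: "(real^'d) set"
  assumes "compact X" "invertible U"
  shows norm_le_mu: "x \<in> X \<Longrightarrow> (norm (matrix_inv U *v complex_vec x))\<^sup>2
      \<le> mu X (matrix_inv (U ** conj_transpose U))"
    and mu_pos: "X \<noteq> {} \<Longrightarrow> X \<noteq> {0} \<Longrightarrow> 0 < mu X (matrix_inv (U ** conj_transpose U))"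
proof -
  let ?f = "\<lambda>x. (norm (matrix_inv U *v complex_vec x))\<^sup>2"
  have mu: "mu X (matrix_inv (U ** conj_transpose U)) = (SUP x\<in>X. ?f x)"
    unfolding mu_def by (simp add: Re_scalar_product_complex_vec inner_inverse_gram[OF assms(2)])
  have "linear (complex_vec :: real^'d \<Rightarrow> complex^'d)"
    by (rule linearI) (simp_all add: complex_vec_def vec_eq_iff scaleR_conv_of_real[where 'a=complex])
  then have "linear (\<lambda>x. matrix_inv U *v complex_vec x)"
    using linear_compose[OF _ linear_matrix_vector_mult_complex] by (auto simp: o_def)
  then have "continuous_on X ?f"
    by (intro continuous_intros linear_continuous_on) (simp add: linear_linear)
  then have "bdd_above (?f ` X)"
    using assms(1) by (intro bounded_imp_bdd_above compact_imp_bounded compact_continuous_image)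
  then show le: "?f x \<le> mu X (matrix_inv (U ** conj_transpose U))" if "x \<in> X" for x
    unfolding mu using that by (intro cSUP_upper)
  assume "X \<noteq> {}" "X \<noteq> {0}"
  then obtain x where x: "x \<in> X" "x \<noteq> 0" by blast
  have "U *v (matrix_inv U *v complex_vec x) = complex_vec x"
    by (simp add: matrix_vector_mul_assoc matrix_inv_mult[OF assms(2)])
  moreover have "complex_vec x \<noteq> 0" using x by (metis norm_complex_vec norm_eq_zero)
  ultimately have "matrix_inv U *v complex_vec x \<noteq> 0" by auto
  then have "0 < ?f x" by simp
  also note le[OF x(1)]
  finally show "0 < mu X (matrix_inv (U ** conj_transpose U))" .
qed

text \<open>The Rayleigh bound for the quadratic part and Cauchy-Schwarz for the linear part give
  \<open>l s\<^sup>2 + 2 \<surd>l V s\<close>; \<open>V_diag\<close> is scaled so that adding \<open>V\<^sup>2\<close> completes the square.\<close>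

lemma quadratic_objective_le:
  fixes U :: "complex^'d^'d" and Q :: "real^'d^'d"
  assumes "transpose Q = Q" "invertible U"
    and y: "norm (matrix_inv U *v complex_vec y) \<le> s"
    and nz: "lambda_max (conj_transpose U ** complex_matrix Q ** U) \<noteq> 0"
  defines "l \<equiv> \<bar>lambda_max (conj_transpose U ** complex_matrix Q ** U)\<bar>"
  shows "y \<bullet> (Q *v y) + q \<bullet> y \<le> (sqrt l * s + V_diag U Q q)\<^sup>2 - (V_diag U Q q)\<^sup>2"
proof -
  let ?B = "conj_transpose U ** complex_matrix Q ** U"
  define z where "z = matrix_inv U *v complex_vec y"
  have Uz: "U *v z = complex_vec y"
    using matrix_inv_mult[OF assms(2)] by (simp add: z_def matrix_vector_mul_assoc)
  have herm: "conj_transpose (complex_matrix Q) = complex_matrix Q"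
    by (simp add: conj_transpose_complex_matrix assms(1))
  have "y \<bullet> (Q *v y) = z \<bullet> (?B *v z)"
    by (simp add: inner_congruence Uz inner_complex_vec flip: complex_matrix_vector_mult)
  also have "\<dots> \<le> lambda_max ?B * (norm z)\<^sup>2"
    by (rule rayleigh_bound[OF hermitian_congruence[OF herm]])
  also have "\<dots> \<le> l * s\<^sup>2"
    using y unfolding l_def z_def[symmetric] by (intro mult_mono power_mono) auto
  finally have quad: "y \<bullet> (Q *v y) \<le> l * s\<^sup>2" .
  have "q \<bullet> y = (conj_transpose U *v complex_vec q) \<bullet> z"
    by (simp add: Uz inner_complex_vec flip: inner_conj_transpose)
  also have "\<dots> \<le> norm (conj_transpose U *v complex_vec q) * norm z"
    by (rule norm_cauchy_schwarz)
  also have "\<dots> \<le> norm (conj_transpose U *v complex_vec q) * s"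
    using y unfolding z_def by (intro mult_left_mono) auto
  also have "norm (conj_transpose U *v complex_vec q) = 2 * sqrt l * V_diag U Q q"
    using nz unfolding V_diag_def l_def by simp
  finally have "q \<bullet> y \<le> 2 * sqrt l * V_diag U Q q * s" .
  with quad show ?thesis
    by (simp add: power2_sum power_mult_distrib l_def mult_ac)
qed

lemma nu_le:
  fixes U D :: "complex^'d^'d" and A Q :: "real^'d^'d"
  assumes "compact X" "X \<noteq> {}" "invertible U" "diagonal_matrix D"
    "complex_matrix A = U ** D ** matrix_inv U" "transpose Q = Q"
    and nz: "lambda_max (conj_transpose U ** complex_matrix Q ** U) \<noteq> 0"
  defines "l \<equiv> \<bar>lambda_max (conj_transpose U ** complex_matrix Q ** U)\<bar>"
    and "m \<equiv> mu X (matrix_inv (U ** conj_transpose U))"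
  shows "nu X A Q q k
    \<le> (sqrt (l * m) * spectral_radius (complex_matrix A) ^ k + V_diag U Q q)\<^sup>2 - (V_diag U Q q)\<^sup>2"
  unfolding nu_def
proof (rule cSUP_least[OF \<open>X \<noteq> {}\<close>])
  fix x assume x: "x \<in> X"
  let ?r = "spectral_radius (complex_matrix A)"
  let ?y = "matrix_power A k *v x"
  have "norm (matrix_inv U *v complex_vec ?y) \<le> ?r ^ k * norm (matrix_inv U *v complex_vec x)"
    using assms(3-5) by (rule norm_diagonal_coordinates_power_le)
  also have "\<dots> \<le> ?r ^ k * sqrt m"
    using assms x unfolding m_def
    by (intro mult_left_mono real_le_rsqrt norm_le_mu zero_le_power spectral_radius_nonneg)
  finally have "?y \<bullet> (Q *v ?y) + q \<bullet> ?y
      \<le> (sqrt l * (?r ^ k * sqrt m) + V_diag U Q q)\<^sup>2 - (V_diag U Q q)\<^sup>2"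
    unfolding l_def using assms(6,3) nz by (intro quadratic_objective_le)
  moreover have "x \<bullet> ((transpose (matrix_power A k) ** Q ** matrix_power A k) *v x)
      = ?y \<bullet> (Q *v ?y)"
  proof -
    have "x \<bullet> ((transpose (matrix_power A k) ** Q ** matrix_power A k) *v x)
        = x \<bullet> (transpose (matrix_power A k) *v (Q *v ?y))"
      by (simp only: matrix_vector_mul_assoc matrix_mul_assoc)
    also have "\<dots> = (x v* transpose (matrix_power A k)) \<bullet> (Q *v ?y)"
      by (rule dot_lmul_matrix[symmetric])
    finally show ?thesis by simp
  qed
  ultimately show "x \<bullet> ((transpose (matrix_power A k) ** Q ** matrix_power A k) *v x) + q \<bullet> ?y
      \<le> (sqrt (l * m) * ?r ^ k + V_diag U Q q)\<^sup>2 - (V_diag U Q q)\<^sup>2"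
    by (simp add: real_sqrt_mult mult_ac)
qed

section \<open>The rank bound\<close>

text \<open>The floor plus one makes \<open>k\<close> strictly larger than \<open>ln c / ln r\<close>, and \<open>ln r < 0\<close> reverses
  the inequality. For \<open>r = 0\<close> the bound is \<open>1\<close>, the first exponent at which \<open>r ^ k\<close> vanishes.\<close>

lemma geometric_less_from_floor_log:
  fixes r c :: real
  assumes "0 \<le> r" "r < 1" "0 < c"
    and "\<lfloor>if r = 0 then 0 else ln c / ln r\<rfloor> + 1 \<le> int k"
  shows "r ^ k < c"
proof (cases "r = 0")
  case True
  then show ?thesis using assms by (simp add: power_0_left)
next
  case False
  then have r: "0 < r" "ln r < 0" using assms by auto
  have "ln c / ln r < real k" using assms(4) False by (simp; linarith)
  then have "ln (r ^ k) < ln c" using r by (simp add: ln_realpow field_simps)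
  then show ?thesis using r assms(3) by simp
qed

lemma floor_log_antimono:
  fixes r c c' :: real
  assumes "0 \<le> r" "r < 1" "0 < c" "c \<le> c'"
  shows "\<lfloor>if r = 0 then 0 else ln c' / ln r\<rfloor> \<le> \<lfloor>if r = 0 then 0 else ln c / ln r\<rfloor>"
  using assms by (intro floor_mono) (auto intro!: divide_right_mono_neg)

text \<open>The number \<open>c j\<close> inside the logarithm is the value of \<open>\<rho>\<^sup>k\<close> at which the majorant of
  \<open>nu_le\<close> equals \<open>\<nu> j\<close>. It is positive and increasing in \<open>\<nu> j\<close>, and \<open>\<rho> < 1\<close> makes the
  logarithmic quotient antitone in it.\<close>

lemma K_diag_correct:
  fixes U D :: "complex^'d^'d" and A Q :: "real^'d^'d"
  assumes "compact X" "X \<noteq> {}" "X \<noteq> {0}" "invertible U" "diagonal_matrix D"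
    "complex_matrix A = U ** D ** matrix_inv U" "spectral_radius (complex_matrix A) < 1"
    "transpose Q = Q" "lambda_max (complex_matrix Q) \<noteq> 0"
    and i: "i \<in> Pos (nu X A Q q)"
  shows K_diag_tail: "K_diag X A U Q q i \<le> int k \<Longrightarrow> nu X A Q q k < nu X A Q q i"
    and K_diag_antimono: "nu X A Q q i \<le> nu X A Q q j \<Longrightarrow>
      K_diag X A U Q q j \<le> K_diag X A U Q q i"
proof -
  let ?r = "spectral_radius (complex_matrix A)"
  define V where "V = V_diag U Q q"
  define l where "l = \<bar>lambda_max (conj_transpose U ** complex_matrix Q ** U)\<bar>"
  define m where "m = mu X (matrix_inv (U ** conj_transpose U))"
  define s where "s = sqrt (l * m)"
  define c where "c = (\<lambda>j. (sqrt (nu X A Q q j + V\<^sup>2) - V) * inverse s)"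
  have K_diag: "K_diag X A U Q q j = \<lfloor>if ?r = 0 then 0 else ln (c j) / ln ?r\<rfloor> + 1" for j
    by (simp add: K_diag_def c_def s_def V_def l_def m_def Let_def)
  have herm: "conj_transpose (complex_matrix Q) = complex_matrix Q"
    by (simp add: conj_transpose_complex_matrix assms(8))
  have nz: "lambda_max (conj_transpose U ** complex_matrix Q ** U) \<noteq> 0"
    using herm assms(4,9) by (rule lambda_max_congruence_nonzero)
  have s: "0 < s"
    using nz mu_pos[OF assms(1,4,2,3)] by (simp add: s_def l_def m_def)
  have V: "0 \<le> V" by (simp add: V_def V_diag_def)
  have r: "0 \<le> ?r" using assms(4-6) by (rule spectral_radius_nonneg)
  have nu_i: "0 < nu X A Q q i" using i by (simp add: Pos_def)
  then have "V < sqrt (nu X A Q q i + V\<^sup>2)" by (intro real_less_rsqrt) simp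
  then have c: "0 < c i" using s by (simp add: c_def)
  show "nu X A Q q k < nu X A Q q i" if "K_diag X A U Q q i \<le> int k"
  proof -
    have "?r ^ k < c i"
      using r assms(7) c that unfolding K_diag by (rule geometric_less_from_floor_log)
    then have "s * ?r ^ k < s * c i" using s by simp
    also have "\<dots> = sqrt (nu X A Q q i + V\<^sup>2) - V" using s by (simp add: c_def field_simps)
    finally have "s * ?r ^ k + V < sqrt (nu X A Q q i + V\<^sup>2)" by simp
    then have "(s * ?r ^ k + V)\<^sup>2 < (sqrt (nu X A Q q i + V\<^sup>2))\<^sup>2"
      using r s V by (intro power_strict_mono) auto
    also have "\<dots> = nu X A Q q i + V\<^sup>2" using nu_i by simp
    finally show ?thesis
      using nu_le[OF assms(1,2,4-6,8) nz, of q k, folded l_def m_def V_def s_def] by simp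
  qed
  show "K_diag X A U Q q j \<le> K_diag X A U Q q i" if "nu X A Q q i \<le> nu X A Q q j"
  proof -
    have "c i \<le> c j" unfolding c_def using that s by (intro mult_right_mono) auto
    then show ?thesis unfolding K_diag
      using floor_log_antimono[OF r assms(7) c] by simp
  qed
qed

theorem corollary2:
  fixes X :: "(real^'d) set"
    and A Q :: "real^'d^'d"
    and q :: "real^'d"
    and U D :: "complex^'d^'d"
  assumes "polytope X" and "X \<noteq> {}" and "X \<noteq> {0}"
    and "spectral_radius (complex_matrix A) < 1"
    and "invertible U" and "diagonal_matrix D"
    and "complex_matrix A = U ** D ** matrix_inv U"
    and "transpose Q = Q"
    and "lambda_max (complex_matrix Q) \<noteq> 0"
    and "Pos (nu X A Q q) \<noteq> {}"
  shows "(\<exists>K. K_geq (nu X A Q q) = enat K \<and>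
              int (K_min X A U Q q) = max (int K) (K_diag X A U Q q K))
       \<and> (\<forall>k \<in> Pos (nu X A Q q).
            S (nu X A Q q) 0 \<infinity> = S (nu X A Q q) 0 (enat (K_min X A U Q q)) \<and>
            S (nu X A Q q) 0 (enat (K_min X A U Q q))
              = S (nu X A Q q) 0 (enat (K_bound X A U Q q k)))"
proof -
  let ?\<nu> = "nu X A Q q" and ?\<kappa> = "K_diag X A U Q q"
  have "compact X" using assms(1) by (rule polytope_imp_compact)
  note tail = K_diag_tail[OF this assms(2,3,5-7,4,8,9)]
    and anti = K_diag_antimono[OF this assms(2,3,5-7,4,8,9)]
  obtain K where K: "K \<in> Pos ?\<nu>" "\<And>k. ?\<nu> k \<le> ?\<nu> K" "\<And>k. k < K \<Longrightarrow> ?\<nu> k < ?\<nu> K"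
    using least_maximiser_exists[of ?\<nu> ?\<kappa>] tail assms(10) by metis
  have bound: "max (int K) (?\<kappa> K) \<le> max (int k) (?\<kappa> k)" if "k \<in> Pos ?\<nu>" for k
    using tail anti K(2) that by (rule rank_bound_minimal_at_maximiser)
  have min: "K_min X A U Q q = K_bound X A U Q q K"
    unfolding K_min_def
  proof (rule Least_equality)
    fix n assume "n \<in> K_bound X A U Q q ` Pos ?\<nu>"
    then show "K_bound X A U Q q K \<le> n"
      using bound by (auto simp: K_bound_def intro!: nat_mono)
  qed (use K(1) in simp)
  have S: "S ?\<nu> 0 (enat (K_bound X A U Q q k)) = ?\<nu> K" if "k \<in> Pos ?\<nu>" for k
    using bound[OF that] by (intro S_eq_maximum K(2)) (auto simp: K_bound_def)
  have "S ?\<nu> 0 \<infinity> = ?\<nu> K" by (intro S_eq_maximum K(2)) auto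
  moreover have "K_geq ?\<nu> = enat K" using K(2,3) by (rule K_geq_eq_least_maximiser)
  moreover have "int (K_min X A U Q q) = max (int K) (?\<kappa> K)"
    unfolding min by (simp add: K_bound_def)
  ultimately show ?thesis using S K(1) by (auto simp: min)
qed

end
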